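(* The complete-graph linearity test on $N$ vertices accepts a function $f:\mathbb{F}_2^m\to\mathbb{F}_2$ with probability at most $$\min\Big(\,2^{-\binom N2}+d(f),\ \ 2^{-N^{2-o(1)}}+d(f)^{N^{1-o(1)}},\ \ 2^{-\Omega(N^2)}+d(f)^{N^{1-o'(1)}}\Big).$$ Here $o(1)$ and $o'(1)$ denote functions of $N$ alone tending to $0$ as $N\to\infty$, and the constant in $\Omega(\cdot)$ is absolute; the bound holds for all sufficiently large $N$, all $m\ge1$ and all $f$.
   Context: The complete-graph linearity test on $N$ vertices: associate with each vertex $v$ of the complete graph $K_N$ an element $x_v\in\mathbb{F}_2^m$ chosen independently and uniformly at random, and for each edge $\{u,v\}$ check whether $f(x_u)+f(x_v)=f(x_u+x_v)$; the test accepts if and only if all $\binom N2$ checks succeed. $d(f)$ is the maximum correlation of $f$ with a linear function, $d(f)=\max_{\alpha\in\mathbb{F}_2^m}\big|\mathbb{E}_{x\in\mathbb{F}_2^m}(-1)^{f(x)+\langle\alpha,x\rangle}\big|$. *)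

theory Defs
  imports "HOL-Probability.Probability" "HOL-Library.Z2" "Jordan_Normal_Form.Matrix"
begin

text \<open>
  The space \<open>F\<^sub>2\<^sup>m\<close> is \<open>carrier_vec m :: bit vec set\<close>, so that the dimension is an ordinary
  natural number. A function on \<open>F\<^sub>2\<^sup>m\<close> is a function \<open>bit vec \<Rightarrow> bit\<close> of which only the values
  on \<open>carrier_vec m\<close> are used.
\<close>

lemma carrier_vec_bit_eq_image:
  "(carrier_vec m :: bit vec set) = vec_of_list ` {bs. set bs \<subseteq> {0, 1} \<and> length bs = m}"
proof -
  have bits: "set bs \<subseteq> {0, 1}" for bs :: "bit list"
  proof
    fix b :: bit
    show "b \<in> {0, 1}" by (cases b) simp_all
  qed
  show ?thesis
  proof (intro equalityI subsetI)
    fix v :: "bit vec" assume "v \<in> carrier_vec m"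
    then have "length (list_of_vec v) = m" by simp
    with bits[of "list_of_vec v"]
    have "vec_of_list (list_of_vec v) \<in> vec_of_list ` {bs. set bs \<subseteq> {0, 1} \<and> length bs = m}"
      by (intro imageI CollectI conjI)
    then show "v \<in> vec_of_list ` {bs. set bs \<subseteq> {0, 1} \<and> length bs = m}"
      by (simp only: vec_list)
  next
    fix v :: "bit vec" assume "v \<in> vec_of_list ` {bs. set bs \<subseteq> {0, 1} \<and> length bs = m}"
    then obtain bs :: "bit list" where "v = vec_of_list bs" "length bs = m" by blast
    then show "v \<in> carrier_vec m" by (simp only: carrier_dim_vec dim_vec_of_list)
  qed
qed

lemma finite_carrier_vec_bit: "finite (carrier_vec m :: bit vec set)"
  unfolding carrier_vec_bit_eq_image by (intro finite_imageI finite_lists_length_eq) simp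

lemma carrier_vec_bit_nonempty: "(carrier_vec m :: bit vec set) \<noteq> {}"
  using zero_carrier_vec by blast

definition sign_bit :: "bit \<Rightarrow> real" where
  "sign_bit b = (-1) ^ (of_bit b :: nat)"

definition max_corr :: "nat \<Rightarrow> (bit vec \<Rightarrow> bit) \<Rightarrow> real" where
  "max_corr m f =
     Max ((\<lambda>\<alpha>. \<bar>measure_pmf.expectation (pmf_of_set (carrier_vec m))
                   (\<lambda>x. sign_bit (f x + scalar_prod \<alpha> x))\<bar>) ` carrier_vec m)"

text \<open>
  The vertices of the complete graph are \<open>{..<N}\<close>; \<open>Pi_pmf\<close> is the product distribution, whose
  samples take the irrelevant default value \<open>0\<^sub>v m\<close> outside \<open>{..<N}\<close>.
\<close>

definition vertex_labels :: "nat \<Rightarrow> nat \<Rightarrow> (nat \<Rightarrow> bit vec) pmf" where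
  "vertex_labels N m = Pi_pmf {..<N} (0\<^sub>v m) (\<lambda>_. pmf_of_set (carrier_vec m))"

definition test_accepts :: "nat \<Rightarrow> (bit vec \<Rightarrow> bit) \<Rightarrow> (nat \<Rightarrow> bit vec) \<Rightarrow> bool" where
  "test_accepts N f x \<longleftrightarrow>
     (\<forall>u<N. \<forall>v<N. u \<noteq> v \<longrightarrow> f (x u) + f (x v) = f (x u + x v))"

definition accept_prob :: "nat \<Rightarrow> nat \<Rightarrow> (bit vec \<Rightarrow> bit) \<Rightarrow> real" where
  "accept_prob N m f = measure_pmf.prob (vertex_labels N m) {x. test_accepts N f x}"

end

(*
  Write F = (-1)^f. The check of an edge {u, v} has indicator
  (1 + F(x_u) F(x_v) F(x_u + x_v)) / 2, and the kernel F(x + y) has operator norm d(f), because the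
  characters diagonalise it. Multiplying out one edge at a time gives the bound 2^(-(N choose 2)) + d(f).

  The other two bounds both follow from 2^(-c N^2) + d(f)^(c N), with epsilon(N) = ln (1/c) / ln N.
  If d(f) is bounded below, it suffices to look at a perfect matching, whose edges are independent
  and each pass with probability at most (1 + d(f)) / 2. If d(f) is small, look at a complete
  bipartite graph with k + k vertices: the graph of passing pairs is pseudorandom, so as the
  vertices of one side are revealed, each of them shrinks the common neighbourhood by a constant
  factor with probability 1 - O(d(f)), unless that neighbourhood already has density below d(f).
*)

theory Submission
  imports Defs "HOL-Real_Asymp.Real_Asymp"
begin

subsection \<open>Averages\<close>

definition avg :: "'a set \<Rightarrow> ('a \<Rightarrow> real) \<Rightarrow> real" where
  "avg A g = sum g A / card A"

lemma avg_cong: "(\<And>x. x \<in> A \<Longrightarrow> g x = h x) \<Longrightarrow> avg A g = avg A h"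
  unfolding avg_def by (metis sum.cong)

lemma avg_mono: "(\<And>x. x \<in> A \<Longrightarrow> g x \<le> h x) \<Longrightarrow> avg A g \<le> avg A h"
  unfolding avg_def by (intro divide_right_mono sum_mono) auto

lemma avg_nonneg: "(\<And>x. x \<in> A \<Longrightarrow> 0 \<le> g x) \<Longrightarrow> 0 \<le> avg A g"
  unfolding avg_def by (intro divide_nonneg_nonneg sum_nonneg) auto

lemma avg_add: "avg A (\<lambda>x. g x + h x) = avg A g + avg A h"
  unfolding avg_def by (simp add: sum.distrib add_divide_distrib)

lemma avg_cmult: "avg A (\<lambda>x. c * g x) = c * avg A g"
  unfolding avg_def by (simp add: sum_distrib_left)

lemma avg_multc: "avg A (\<lambda>x. g x * c) = avg A g * c"
  unfolding avg_def by (simp add: sum_distrib_right)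

lemma avg_const: "finite A \<Longrightarrow> A \<noteq> {} \<Longrightarrow> avg A (\<lambda>_. c) = c"
  unfolding avg_def by simp

lemma avg_le_const:
  "finite A \<Longrightarrow> A \<noteq> {} \<Longrightarrow> (\<And>x. x \<in> A \<Longrightarrow> g x \<le> c) \<Longrightarrow> avg A g \<le> c"
  by (metis avg_const avg_mono)

lemma avg_swap: "avg A (\<lambda>x. avg B (g x)) = avg B (\<lambda>y. avg A (\<lambda>x. g x y))"
proof -
  have "(\<Sum>x\<in>A. \<Sum>y\<in>B. g x y) = (\<Sum>y\<in>B. \<Sum>x\<in>A. g x y)" by (rule sum.swap)
  then show ?thesis
    unfolding avg_def by (simp add: sum_divide_distrib[symmetric] mult.commute)
qed

lemma expectation_eq_avg:
  "finite A \<Longrightarrow> A \<noteq> {} \<Longrightarrow> measure_pmf.expectation (pmf_of_set A) g = avg A g"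
  unfolding avg_def by (rule integral_pmf_of_set)

text \<open>Fubini for one vertex: a uniform labelling of \<open>insert u A\<close> is an
  independent pair of a uniform label at \<open>u\<close> and a uniform labelling of
  \<open>A\<close>. Independence comes from \<open>Pi_pmf\<close>, which is uniform on
  \<open>PiE_dflt\<close>. Every later argument that reveals a vertex goes through this
  rule.\<close>

lemma avg_PiE_dflt_insert:
  assumes "finite A" "u \<notin> A" "finite B" "B \<noteq> {}"
  shows "avg (PiE_dflt (insert u A) c (\<lambda>_. B)) h
    = avg B (\<lambda>z. avg (PiE_dflt A c (\<lambda>_. B)) (\<lambda>x. h (x(u := z))))"
proof -
  let ?p = "\<lambda>_. pmf_of_set B"
  have Pi: "Pi_pmf A' c ?p = pmf_of_set (PiE_dflt A' c (\<lambda>_. B))"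
    and fin: "finite (PiE_dflt A' c (\<lambda>_. B))" and ne: "PiE_dflt A' c (\<lambda>_. B) \<noteq> {}"
    if "finite A'" for A'
    using assms that by (auto intro!: Pi_pmf_of_set)
  have fin': "finite (set_pmf (Pi_pmf A c ?p))"
    using Pi[OF assms(1)] fin[OF assms(1)] ne[OF assms(1)] by simp
  have "avg (PiE_dflt (insert u A) c (\<lambda>_. B)) h
      = measure_pmf.expectation (Pi_pmf (insert u A) c ?p) h"
    using assms by (simp only: Pi fin ne expectation_eq_avg finite_insert not_False_eq_True)
  also have "Pi_pmf (insert u A) c ?p
      = pmf_of_set B \<bind> (\<lambda>z. map_pmf (\<lambda>x. x(u := z)) (Pi_pmf A c ?p))"
    using assms by (subst Pi_pmf_insert') (auto simp: map_pmf_def)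
  also have "measure_pmf.expectation \<dots> h
      = avg B (\<lambda>z. measure_pmf.expectation (map_pmf (\<lambda>x. x(u := z)) (Pi_pmf A c ?p)) h)"
    using assms fin'
    by (subst pmf_expectation_bind_pmf_of_set)
       (auto simp: avg_def sum_divide_distrib field_simps)
  also have "\<dots> = avg B (\<lambda>z. avg (PiE_dflt A c (\<lambda>_. B)) (\<lambda>x. h (x(u := z))))"
    using assms Pi[OF assms(1)] fin[OF assms(1)] ne[OF assms(1)]
    by (simp add: expectation_eq_avg)
  finally show ?thesis .
qed

subsection \<open>Fourier analysis\<close>

lemma sign_bit_simps [simp]: "sign_bit 0 = 1" "sign_bit 1 = -1"
  by (simp_all add: sign_bit_def)

lemma sign_bit_add: "sign_bit (a + b) = sign_bit a * sign_bit b"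
  by (cases a; cases b) simp_all

text \<open>Rewriting sums of bits to xor would keep \<open>sign_bit_add\<close> from
  matching.\<close>

declare add_bit_eq_xor [simp del]

lemma sign_bit_sq [simp]: "sign_bit a * sign_bit a = 1"
  by (cases a) simp_all

lemma sign_bit_bounds [simp]: "-1 \<le> sign_bit a" "sign_bit a \<le> 1"
  by (cases a; simp)+

lemma abs_sign_bit [simp]: "\<bar>sign_bit a\<bar> = 1"
  by (cases a) simp_all

lemma bit_vec_add_eq_0_iff:
  fixes x y :: "bit vec"
  assumes "x \<in> carrier_vec m" "y \<in> carrier_vec m"
  shows "x + y = 0\<^sub>v m \<longleftrightarrow> x = y"
proof -
  have "a + b = 0 \<longleftrightarrow> a = b" for a b :: bit by (cases a; cases b) simp_all
  then show ?thesis using assms by (auto simp: vec_eq_iff)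
qed

text \<open>Orthogonality of characters. If \<open>z\<close> has a coordinate \<open>i\<close> equal
  to 1, translating by the unit vector at \<open>i\<close> permutes the space and flips the sign of
  every term, so the sum equals its own negative.\<close>

lemma sum_characters:
  assumes z: "z \<in> carrier_vec m"
  shows "(\<Sum>\<alpha>\<in>carrier_vec m. sign_bit (scalar_prod \<alpha> z))
    = (if z = 0\<^sub>v m then real (card (carrier_vec m :: bit vec set)) else 0)"
proof (cases "z = 0\<^sub>v m")
  case True
  have "(\<Sum>\<alpha>\<in>carrier_vec m. sign_bit (scalar_prod \<alpha> z)) = (\<Sum>\<alpha>\<in>(carrier_vec m :: bit vec set). 1)"
    using True by (intro sum.cong) auto
  then show ?thesis using True by simp
next
  case False
  then obtain i where i: "i < m" "z $ i = 1"
    using z by (auto simp: vec_eq_iff)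
  let ?e = "unit_vec m i :: bit vec" and ?V = "carrier_vec m :: bit vec set"
  \<comment> \<open>In characteristic 2 the translation is an involution, so it serves as its own
    inverse in the reindexing.\<close>
  have ee: "\<alpha> + (?e + ?e) = \<alpha>" if "\<alpha> \<in> ?V" for \<alpha>
    using that bit_vec_add_eq_0_iff[of ?e m ?e] by simp
  have "(\<Sum>\<alpha>\<in>?V. sign_bit (scalar_prod \<alpha> z)) = (\<Sum>\<alpha>\<in>?V. sign_bit (scalar_prod (\<alpha> + ?e) z))"
    by (rule sum.reindex_bij_witness[where i = "\<lambda>\<alpha>. \<alpha> + ?e" and j = "\<lambda>\<alpha>. \<alpha> + ?e"])
       (auto simp: assoc_add_vec[of _ m] ee)
  also have "\<dots> = (\<Sum>\<alpha>\<in>?V. - sign_bit (scalar_prod \<alpha> z))"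
    using z i by (intro sum.cong) (auto simp: add_scalar_prod_distrib[of _ m] sign_bit_add)
  finally show ?thesis using False by (simp add: sum_negf)
qed

context
  fixes m :: nat and f :: "bit vec \<Rightarrow> bit"
begin

abbreviation (input) V :: "bit vec set" where "V \<equiv> carrier_vec m"

abbreviation (input) F :: "bit vec \<Rightarrow> real" where "F x \<equiv> sign_bit (f x)"

abbreviation (input) d :: real where "d \<equiv> max_corr m f"

text \<open>The transform is unnormalised; the missing factors \<open>card V\<close> reappear in the
  inversion formula and in \<open>parseval\<close>.\<close>

definition fourier :: "(bit vec \<Rightarrow> real) \<Rightarrow> bit vec \<Rightarrow> real" where
  "fourier g \<alpha> = (\<Sum>x\<in>V. g x * sign_bit (scalar_prod \<alpha> x))"

lemma finite_V [simp, intro]: "finite V"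
  by (rule finite_carrier_vec_bit)

lemma V_nonempty [simp]: "V \<noteq> {}"
  by (rule carrier_vec_bit_nonempty)

lemma card_V_pos: "0 < card V"
  by (simp add: card_gt_0_iff)

lemma abs_fourier_le: "\<alpha> \<in> V \<Longrightarrow> \<bar>fourier F \<alpha>\<bar> \<le> card V * d"
proof -
  assume \<alpha>: "\<alpha> \<in> V"
  have "\<bar>avg V (\<lambda>x. sign_bit (f x + scalar_prod \<alpha> x))\<bar> \<le> d"
    unfolding max_corr_def using \<alpha> by (intro Max_ge) (auto simp: expectation_eq_avg)
  moreover have "avg V (\<lambda>x. sign_bit (f x + scalar_prod \<alpha> x)) = fourier F \<alpha> / card V"
    unfolding avg_def fourier_def sign_bit_add by simp
  ultimately show ?thesis
    using card_V_pos by (simp add: abs_div field_simps)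
qed

lemma max_corr_nonneg: "0 \<le> d"
proof -
  have "0\<^sub>v m \<in> V" by simp
  from abs_fourier_le[OF this] have "0 \<le> card V * d" by linarith
  then show ?thesis using card_V_pos by (simp add: zero_le_mult_iff)
qed

lemma max_corr_le_1: "d \<le> 1"
proof -
  have "\<bar>avg V (\<lambda>x. sign_bit (f x + scalar_prod \<alpha> x))\<bar> \<le> 1" for \<alpha>
  proof (rule abs_leI)
    show "avg V (\<lambda>x. sign_bit (f x + scalar_prod \<alpha> x)) \<le> 1"
      by (rule avg_le_const) auto
    have "avg V (\<lambda>x. (-1) * sign_bit (f x + scalar_prod \<alpha> x)) \<le> 1"
      by (rule avg_le_const) (auto simp: minus_le_iff)
    then show "- avg V (\<lambda>x. sign_bit (f x + scalar_prod \<alpha> x)) \<le> 1"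
      unfolding avg_cmult by simp
  qed
  then show ?thesis
    unfolding max_corr_def by (subst Max_le_iff) (auto simp: expectation_eq_avg)
qed

text \<open>Fourier inversion: after swapping the sums, orthogonality keeps only the
  \<open>x\<close> with \<open>x + z = 0\<close>, which over the two-element field means
  \<open>x = z\<close>.\<close>

lemma sum_fourier_mult_character:
  assumes z: "z \<in> V"
  shows "(\<Sum>\<alpha>\<in>V. fourier g \<alpha> * sign_bit (scalar_prod \<alpha> z)) = real (card V) * g z"
proof -
  have "(\<Sum>\<alpha>\<in>V. fourier g \<alpha> * sign_bit (scalar_prod \<alpha> z))
      = (\<Sum>\<alpha>\<in>V. \<Sum>x\<in>V. g x * sign_bit (scalar_prod \<alpha> (x + z)))"
    unfolding fourier_def sum_distrib_right using z
    by (intro sum.cong) (auto simp: scalar_prod_add_distrib[of _ m] sign_bit_add)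
  also have "\<dots> = (\<Sum>x\<in>V. g x * (\<Sum>\<alpha>\<in>V. sign_bit (scalar_prod \<alpha> (x + z))))"
    by (subst sum.swap) (simp add: sum_distrib_left)
  also have "\<dots> = (\<Sum>x\<in>V. if x = z then g x * real (card V) else 0)"
    using z by (intro sum.cong) (auto simp: sum_characters bit_vec_add_eq_0_iff)
  also have "\<dots> = real (card V) * g z"
    using z by simp
  finally show ?thesis .
qed

lemma parseval: "(\<Sum>\<alpha>\<in>V. (fourier g \<alpha>)\<^sup>2) = real (card V) * (\<Sum>x\<in>V. (g x)\<^sup>2)"
proof -
  have "(\<Sum>\<alpha>\<in>V. (fourier g \<alpha>)\<^sup>2)
      = (\<Sum>\<alpha>\<in>V. \<Sum>x\<in>V. g x * (fourier g \<alpha> * sign_bit (scalar_prod \<alpha> x)))"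
    by (intro sum.cong) (auto simp: power2_eq_square fourier_def sum_distrib_left mult_ac)
  also have "\<dots> = (\<Sum>x\<in>V. g x * (real (card V) * g x))"
    by (subst sum.swap) (simp add: sum_distrib_left[symmetric] sum_fourier_mult_character)
  finally show ?thesis
    by (simp add: sum_distrib_left power2_eq_square mult_ac)
qed

text \<open>The operator \<open>(x, y) \<mapsto> F (x + y)\<close> is diagonalised by the characters, and its eigenvalues
  are the correlations of \<open>f\<close> with the linear functions.\<close>

lemma bilinear_bound:
  "\<bar>avg V (\<lambda>x. avg V (\<lambda>y. g x * h y * F (x + y)))\<bar>
    \<le> d * sqrt (avg V (\<lambda>x. (g x)\<^sup>2)) * sqrt (avg V (\<lambda>x. (h x)\<^sup>2))"
proof -
  define n where "n = real (card V)"
  have n: "n > 0" using card_V_pos by (simp add: n_def)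
  define S where "S = (\<Sum>x\<in>V. \<Sum>y\<in>V. g x * h y * F (x + y))"
  define G where "G = (\<Sum>x\<in>V. (g x)\<^sup>2)"
  define H where "H = (\<Sum>x\<in>V. (h x)\<^sup>2)"
  have GH: "G \<ge> 0" "H \<ge> 0" by (auto simp: G_def H_def intro: sum_nonneg)
  \<comment> \<open>Inversion replaces \<open>F (x + y)\<close> by characters of
    \<open>x + y\<close>, each of which factors into a part in \<open>x\<close> and a part in
    \<open>y\<close>. The double sum then decouples into a product of three transforms for each
    frequency.\<close>
  have "n * S = (\<Sum>x\<in>V. \<Sum>y\<in>V. g x * h y * (\<Sum>\<alpha>\<in>V. fourier F \<alpha> * sign_bit (scalar_prod \<alpha> (x + y))))"
    unfolding S_def sum_distrib_left[of n]
    by (intro sum.cong) (simp_all add: sum_fourier_mult_character n_def)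
  also have "\<dots> = (\<Sum>x\<in>V. \<Sum>y\<in>V. \<Sum>\<alpha>\<in>V. fourier F \<alpha> * (g x * sign_bit (scalar_prod \<alpha> x)) * (h y * sign_bit (scalar_prod \<alpha> y)))"
    unfolding sum_distrib_left
    by (intro sum.cong) (auto simp: scalar_prod_add_distrib[of _ m] sign_bit_add mult_ac)
  also have "\<dots> = (\<Sum>x\<in>V. \<Sum>\<alpha>\<in>V. \<Sum>y\<in>V. fourier F \<alpha> * (g x * sign_bit (scalar_prod \<alpha> x)) * (h y * sign_bit (scalar_prod \<alpha> y)))"
    by (intro sum.cong refl sum.swap)
  also have "\<dots> = (\<Sum>\<alpha>\<in>V. \<Sum>x\<in>V. \<Sum>y\<in>V. fourier F \<alpha> * (g x * sign_bit (scalar_prod \<alpha> x)) * (h y * sign_bit (scalar_prod \<alpha> y)))"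
    by (rule sum.swap)
  also have "\<dots> = (\<Sum>\<alpha>\<in>V. fourier F \<alpha> * fourier g \<alpha> * fourier h \<alpha>)"
    by (simp add: fourier_def[of g] fourier_def[of h] sum_distrib_left sum_distrib_right)
       (intro sum.cong refl sum.swap)
  finally have "n * \<bar>S\<bar> = \<bar>\<Sum>\<alpha>\<in>V. fourier F \<alpha> * fourier g \<alpha> * fourier h \<alpha>\<bar>"
    using n by (metis abs_mult abs_of_pos)
  also have "\<dots> \<le> (\<Sum>\<alpha>\<in>V. n * d * (\<bar>fourier g \<alpha>\<bar> * \<bar>fourier h \<alpha>\<bar>))"
    using abs_fourier_le
    by (intro order_trans[OF sum_abs] sum_mono)
       (auto simp: abs_mult n_def mult.assoc[symmetric] intro!: mult_right_mono)
  also have "\<dots> = n * d * (\<Sum>\<alpha>\<in>V. \<bar>fourier g \<alpha>\<bar> * \<bar>fourier h \<alpha>\<bar>)"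
    by (simp add: sum_distrib_left)
  also have "\<dots> \<le> n * d * (n * (sqrt G * sqrt H))"
  proof (rule mult_left_mono)
    \<comment> \<open>Cauchy-Schwarz over the frequencies, then Parseval for \<open>g\<close> and
      for \<open>h\<close>.\<close>
    have "(\<Sum>\<alpha>\<in>V. \<bar>fourier g \<alpha>\<bar> * \<bar>fourier h \<alpha>\<bar>) \<le> sqrt ((n * G) * (n * H))"
      using Cauchy_Schwarz_ineq_sum[of "\<lambda>\<alpha>. \<bar>fourier g \<alpha>\<bar>" "\<lambda>\<alpha>. \<bar>fourier h \<alpha>\<bar>" V]
      by (intro real_le_rsqrt) (simp add: parseval n_def G_def H_def)
    also have "\<dots> = n * (sqrt G * sqrt H)"
      using n by (simp add: real_sqrt_mult)
    finally show "(\<Sum>\<alpha>\<in>V. \<bar>fourier g \<alpha>\<bar> * \<bar>fourier h \<alpha>\<bar>) \<le> n * (sqrt G * sqrt H)" .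
  qed (use n max_corr_nonneg in simp)
  finally have "n * \<bar>S\<bar> \<le> n * (d * (n * (sqrt G * sqrt H)))"
    by (simp only: mult.assoc)
  then have "\<bar>S\<bar> \<le> d * (n * (sqrt G * sqrt H))"
    using n by simp
  then have "\<bar>S\<bar> / n\<^sup>2 \<le> d * (sqrt G * sqrt H / n)"
    using n by (simp add: field_simps power2_eq_square)
  moreover have "avg V (\<lambda>x. avg V (\<lambda>y. g x * h y * F (x + y))) = S / n\<^sup>2"
    by (simp add: avg_def S_def n_def sum_divide_distrib power2_eq_square)
  moreover have "sqrt (avg V (\<lambda>x. (g x)\<^sup>2)) * sqrt (avg V (\<lambda>x. (h x)\<^sup>2)) = sqrt G * sqrt H / n"
    using n by (simp add: avg_def real_sqrt_divide G_def H_def n_def)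
  ultimately show ?thesis
    by (simp add: mult.assoc)
qed

lemma bilinear_bound_bounded:
  assumes "\<And>x. x \<in> V \<Longrightarrow> \<bar>g x\<bar> \<le> 1" "\<And>x. x \<in> V \<Longrightarrow> \<bar>h x\<bar> \<le> 1"
  shows "\<bar>avg V (\<lambda>x. avg V (\<lambda>y. g x * h y * F (x + y)))\<bar> \<le> d"
proof -
  have "avg V (\<lambda>x. (g x)\<^sup>2) \<le> 1" "avg V (\<lambda>x. (h x)\<^sup>2) \<le> 1"
    using assms by (auto intro!: avg_le_const simp: abs_square_le_1)
  then have "d * (sqrt (avg V (\<lambda>x. (g x)\<^sup>2)) * sqrt (avg V (\<lambda>x. (h x)\<^sup>2))) \<le> d * (1 * 1)"
    using max_corr_nonneg
    by (intro mult_left_mono mult_mono) (auto intro!: avg_nonneg)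
  then show ?thesis using bilinear_bound[of g h] by (simp add: mult.assoc)
qed

subsection \<open>The test as an average over labellings\<close>

definition edge :: "bit vec \<Rightarrow> bit vec \<Rightarrow> real" where
  "edge x y = of_bool (f x + f y = f (x + y))"

abbreviation (input) labels :: "nat set \<Rightarrow> (nat \<Rightarrow> bit vec) set" where
  "labels A \<equiv> PiE_dflt A (0\<^sub>v m) (\<lambda>_. V)"

lemma edge_eq: "edge x y = (1 + F x * F y * F (x + y)) / 2"
proof -
  have "of_bool (a + b = c) = (1 + sign_bit a * sign_bit b * sign_bit c) / 2" for a b c
    by (cases a; cases b; cases c) (simp_all add: add_bit_eq_xor)
  then show ?thesis by (simp add: edge_def)
qed

lemma edge_bounds: "0 \<le> edge x y" "edge x y \<le> 1"
  by (simp_all add: edge_def)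

lemma finite_labels [simp, intro]: "finite A \<Longrightarrow> finite (labels A)"
  by auto

lemma labels_nonempty [simp]: "labels A \<noteq> {}"
  by simp

lemma labels_in_V: "x \<in> labels A \<Longrightarrow> u \<in> A \<Longrightarrow> x u \<in> V"
  by (auto simp: PiE_dflt_def)

lemmas avg_labels_insert = avg_PiE_dflt_insert[OF _ _ finite_V V_nonempty]

lemma accept_prob_eq:
  "accept_prob N m f = avg (labels {..<N}) (\<lambda>x. of_bool (test_accepts N f x))"
proof -
  have "vertex_labels N m = pmf_of_set (labels {..<N})"
    unfolding vertex_labels_def by (rule Pi_pmf_of_set) auto
  then have "accept_prob N m f = measure_pmf.expectation (pmf_of_set (labels {..<N}))
      (indicator {x. test_accepts N f x})"
    by (simp add: accept_prob_def)
  also have "\<dots> = avg (labels {..<N}) (indicator {x. test_accepts N f x})"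
    by (rule expectation_eq_avg) auto
  finally show ?thesis by (simp add: indicator_def[abs_def])
qed

lemma accept_prob_nonneg: "0 \<le> accept_prob N m f"
  by (simp add: accept_prob_def)

lemma accept_prob_le_1: "accept_prob N m f \<le> 1"
  by (simp add: accept_prob_def)

lemma test_accepts_restrict:
  assumes "test_accepts K f y" "N \<le> K" "\<And>u. u < N \<Longrightarrow> y u = x u"
  shows "test_accepts N f x"
  unfolding test_accepts_def
proof (intro allI impI)
  fix u v assume "u < N" "v < N" "u \<noteq> v"
  then show "f (x u) + f (x v) = f (x u + x v)"
    using assms(1)[unfolded test_accepts_def, rule_format, of u v] assms(2,3) by simp
qed

text \<open>Whatever the label of the new vertex, acceptance on \<open>Suc N\<close> vertices
  includes all checks among the first \<open>N\<close>. The resulting monotonicity allows a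
  restriction to an even number of vertices.\<close>

lemma accept_prob_Suc_le: "accept_prob (Suc N) m f \<le> accept_prob N m f"
proof -
  have "accept_prob (Suc N) m f
      = avg V (\<lambda>z. avg (labels {..<N}) (\<lambda>x. of_bool (test_accepts (Suc N) f (x(N := z)))))"
    unfolding accept_prob_eq lessThan_Suc by (rule avg_labels_insert) auto
  also have "\<dots> \<le> avg V (\<lambda>z. accept_prob N m f)"
    unfolding accept_prob_eq
    by (intro avg_mono) (auto intro: test_accepts_restrict)
  finally show ?thesis by (simp add: avg_const)
qed

lemma accept_prob_antimono: "M \<le> N \<Longrightarrow> accept_prob N m f \<le> accept_prob M m f"
  by (rule lift_Suc_antimono_le[of "\<lambda>N. accept_prob N m f"]) (rule accept_prob_Suc_le)

subsection \<open>Checking the edges one by one\<close>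

text \<open>Since the edge of \<open>u\<close> and \<open>v\<close> is not in \<open>E\<close>, no
  factor of the product depends on both labels. With all other labels fixed, the product splits into
  a function of \<open>x u\<close> times a function of \<open>x v\<close>, both bounded by 1, and
  the bilinear bound applies.\<close>

lemma avg_edges_twisted_le:
  assumes A: "finite A" "u \<in> A" "v \<in> A" "u < v"
    and E: "finite E" "E \<subseteq> {(u, v). u < v}" "(u, v) \<notin> E"
  shows "avg (labels A) (\<lambda>x. (\<Prod>e\<in>E. edge (x (fst e)) (x (snd e))) * (F (x u) * F (x v) * F (x u + x v))) \<le> d"
    (is "avg _ ?h \<le> d")
proof -
  define A' where "A' = A - {u, v}"
  have A': "A = insert u (insert v A')" "u \<notin> insert v A'" "v \<notin> A'" "finite A'"
    using A by (auto simp: A'_def)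
  have "avg (labels A) ?h = avg V (\<lambda>y. avg (labels (insert v A')) (\<lambda>x. ?h (x(u := y))))"
    unfolding A'(1) using A' by (intro avg_labels_insert) auto
  also have "\<dots> = avg V (\<lambda>y. avg V (\<lambda>z. avg (labels A') (\<lambda>x. ?h (x(v := z, u := y)))))"
    using A' by (intro avg_cong avg_labels_insert) auto
  \<comment> \<open>The averages over the labels of \<open>u\<close> and \<open>v\<close> move to
    the inside, so that the other labels can be fixed.\<close>
  also have "\<dots> = avg V (\<lambda>y. avg (labels A') (\<lambda>x. avg V (\<lambda>z. ?h (x(v := z, u := y)))))"
    by (subst avg_swap) (rule refl)
  also have "\<dots> = avg (labels A') (\<lambda>x. avg V (\<lambda>y. avg V (\<lambda>z. ?h (x(v := z, u := y)))))"
    by (rule avg_swap)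
  also have "\<dots> \<le> d"
  proof (rule avg_le_const)
    fix x assume "x \<in> labels A'"
    \<comment> \<open>\<open>B\<close> consists of the pairs that touch \<open>u\<close>. Edges in
      \<open>E \<inter> B\<close> avoid \<open>v\<close>: one orientation is excluded by hypothesis,
      the other by the ordering of the pairs. All remaining edges, including those that touch
      neither vertex, go into \<open>H\<close>.\<close>
    define B where "B = {e. fst e = u \<or> snd e = u}"
    define p where "p x e = edge (x (fst e)) (x (snd e))" for x :: "nat \<Rightarrow> bit vec" and e
    define G where "G y = (\<Prod>e\<in>E \<inter> B. p (x(u := y)) e)" for y
    define H where "H z = (\<Prod>e\<in>E - B. p (x(v := z)) e)" for z
    have p: "0 \<le> p x e" "p x e \<le> 1" for x e
      by (simp_all add: p_def edge_bounds)
    have split: "(\<Prod>e\<in>E. p (x(v := z, u := y)) e) = G y * H z" for y z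
    proof -
      have "(\<Prod>e\<in>E \<inter> B. p (x(v := z, u := y)) e) = G y"
        unfolding G_def p_def B_def using E A by (intro prod.cong refl) auto
      moreover have "(\<Prod>e\<in>E - B. p (x(v := z, u := y)) e) = H z"
        unfolding H_def p_def B_def using E A by (intro prod.cong refl) auto
      ultimately show ?thesis using prod.Int_Diff[OF E(1), of _ B] by metis
    qed
    have "\<bar>G y\<bar> \<le> 1" "\<bar>H y\<bar> \<le> 1" for y
      unfolding G_def H_def using p by (auto simp: abs_prod intro!: prod_le_1)
    then have "\<bar>avg V (\<lambda>y. avg V (\<lambda>z. (G y * F y) * (H z * F z) * F (y + z)))\<bar> \<le> d"
      by (intro bilinear_bound_bounded) (auto simp: abs_mult)
    moreover have "?h (x(v := z, u := y)) = (G y * F y) * (H z * F z) * F (y + z)" for y z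
      using split[of z y] A(4) by (simp add: p_def)
    ultimately show "avg V (\<lambda>y. avg V (\<lambda>z. ?h (x(v := z, u := y)))) \<le> d"
      by (simp only: abs_le_iff)
  qed (use A' in auto)
  finally show ?thesis .
qed

text \<open>The errors do not accumulate: a new edge halves the old bound and adds an error of
  \<open>d / 2\<close>, and \<open>d / 2 + d / 2 = d\<close>.\<close>

lemma avg_edges_le:
  assumes "finite A" "finite E" "E \<subseteq> {(u, v). u \<in> A \<and> v \<in> A \<and> u < v}"
  shows "avg (labels A) (\<lambda>x. \<Prod>e\<in>E. edge (x (fst e)) (x (snd e))) \<le> (1 / 2) ^ card E + d"
  using assms(2,3)
proof (induction E)
  case empty
  then show ?case using assms(1) max_corr_nonneg by (simp add: avg_const)
next
  case (insert e E)
  obtain u v where e: "e = (u, v)" by (cases e)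
  let ?Q = "\<lambda>x. \<Prod>e\<in>E. edge (x (fst e)) (x (snd e))"
  let ?T = "\<lambda>x. F (x u) * F (x v) * F (x u + x v)"
  have "avg (labels A) (\<lambda>x. \<Prod>e\<in>insert e E. edge (x (fst e)) (x (snd e)))
      = avg (labels A) (\<lambda>x. 1 / 2 * ?Q x + 1 / 2 * (?Q x * ?T x))"
    using insert.hyps by (intro avg_cong) (simp add: e edge_eq[of "_ u" "_ v"] field_simps)
  also have "\<dots> = 1 / 2 * avg (labels A) ?Q + 1 / 2 * avg (labels A) (\<lambda>x. ?Q x * ?T x)"
    by (simp only: avg_add avg_cmult)
  also have "\<dots> \<le> 1 / 2 * ((1 / 2) ^ card E + d) + 1 / 2 * d"
    using insert assms(1) by (intro add_mono mult_left_mono avg_edges_twisted_le) (auto simp: e)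
  also have "\<dots> = (1 / 2) ^ card (insert e E) + d"
    using insert.hyps by (simp add: field_simps)
  finally show ?case .
qed

lemma accept_prob_le_edges: "accept_prob N m f \<le> (1 / 2) ^ (N choose 2) + d"
proof -
  \<comment> \<open>Each edge occurs once, smaller endpoint first. Grouping by the larger endpoint
    \<open>v\<close> gives \<open>v\<close> edges for each \<open>v < N\<close>, which sum to
    \<open>N choose 2\<close>.\<close>
  define E where "E = (\<lambda>(v, u). (u, v)) ` (SIGMA v:{..<N}. {..<v})"
  have "card E = card (SIGMA v:{..<N}. {..<v})"
    unfolding E_def by (rule card_image) (auto simp: inj_on_def)
  also have "\<dots> = N choose 2"
    by (induction N) (auto simp: card_SigmaI numeral_2_eq_2)
  finally have card: "card E = N choose 2" .
  have "accept_prob N m f \<le> avg (labels {..<N}) (\<lambda>x. \<Prod>e\<in>E. edge (x (fst e)) (x (snd e)))"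
    unfolding accept_prob_eq
  proof (rule avg_mono)
    fix x
    show "of_bool (test_accepts N f x) \<le> (\<Prod>e\<in>E. edge (x (fst e)) (x (snd e)))"
    proof (cases "test_accepts N f x")
      case True
      then have "(\<Prod>e\<in>E. edge (x (fst e)) (x (snd e))) = 1"
        by (intro prod.neutral) (auto simp: E_def edge_def test_accepts_def)
      then show ?thesis by simp
    qed (auto intro: prod_nonneg edge_bounds)
  qed
  also have "\<dots> \<le> (1 / 2) ^ card E + d"
    by (rule avg_edges_le) (auto simp: E_def)
  finally show ?thesis by (simp add: card)
qed

subsection \<open>A perfect matching\<close>

lemma avg_edge_le: "avg V (\<lambda>y. avg V (edge y)) \<le> (1 + d) / 2"
proof -
  have "avg V (\<lambda>y. avg V (\<lambda>z. F y * F z * F (y + z))) \<le> d"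
    using bilinear_bound_bounded[of F F] by simp
  moreover have "avg V (\<lambda>y. avg V (edge y))
      = avg V (\<lambda>y. avg V (\<lambda>z. 1 / 2 + 1 / 2 * (F y * F z * F (y + z))))"
    by (intro avg_cong) (simp add: edge_eq field_simps)
  ultimately show ?thesis by (simp only: avg_add avg_cmult) (simp add: avg_const)
qed

text \<open>Only the edge between the two new vertices and the checks among the old ones are kept;
  these involve disjoint labels and are therefore independent.\<close>

lemma accept_prob_add_2_le:
  "accept_prob (Suc (Suc N)) m f \<le> (1 + d) / 2 * accept_prob N m f"
proof -
  let ?h = "\<lambda>x. of_bool (test_accepts (Suc (Suc N)) f x) :: real"
  have "accept_prob (Suc (Suc N)) m f
      = avg V (\<lambda>y. avg (labels {..<Suc N}) (\<lambda>x. ?h (x(Suc N := y))))"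
    unfolding accept_prob_eq lessThan_Suc[of "Suc N"] by (rule avg_labels_insert) auto
  also have "\<dots> = avg V (\<lambda>y. avg V (\<lambda>z. avg (labels {..<N}) (\<lambda>x. ?h (x(N := z, Suc N := y)))))"
    by (simp only: lessThan_Suc avg_labels_insert finite_lessThan lessThan_iff less_irrefl not_False_eq_True)
  also have "\<dots> \<le> avg V (\<lambda>y. avg V (\<lambda>z. avg (labels {..<N}) (\<lambda>x. edge y z * of_bool (test_accepts N f x))))"
  proof (intro avg_mono)
    fix y z x
    show "?h (x(N := z, Suc N := y)) \<le> edge y z * of_bool (test_accepts N f x)"
    proof (cases "test_accepts (Suc (Suc N)) f (x(N := z, Suc N := y))")
      case True
      have "f y + f z = f (y + z)"
        using True[unfolded test_accepts_def, rule_format, of "Suc N" N] by simp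
      moreover have "test_accepts N f x"
        using True by (rule test_accepts_restrict) auto
      ultimately show ?thesis by (simp add: edge_def)
    qed (simp add: edge_bounds)
  qed
  also have "\<dots> = avg V (\<lambda>y. avg V (edge y)) * accept_prob N m f"
    by (simp add: avg_cmult avg_multc accept_prob_eq)
  also have "\<dots> \<le> (1 + d) / 2 * accept_prob N m f"
    by (intro mult_right_mono avg_edge_le accept_prob_nonneg)
  finally show ?thesis .
qed

lemma accept_prob_le_matching: "accept_prob (2 * k) m f \<le> ((1 + d) / 2) ^ k"
proof (induction k)
  case 0
  show ?case by (simp add: accept_prob_le_1)
next
  case (Suc k)
  have "accept_prob (2 * Suc k) m f \<le> (1 + d) / 2 * accept_prob (2 * k) m f"
    using accept_prob_add_2_le[of "2 * k"] by simp
  also have "\<dots> \<le> (1 + d) / 2 * ((1 + d) / 2) ^ k"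
    using Suc max_corr_nonneg by (intro mult_left_mono) auto
  finally show ?case by simp
qed

subsection \<open>A complete bipartite graph\<close>

definition density :: "bit vec set \<Rightarrow> real" where
  "density B = avg V (\<lambda>y. of_bool (y \<in> B))"

definition nbhd :: "bit vec set \<Rightarrow> bit vec \<Rightarrow> bit vec set" where
  "nbhd B z = {y \<in> B. f z + f y = f (z + y)}"

text \<open>\<open>B\<close> plays the role of the common neighbourhood of the vertices already
  revealed, which makes a recursion on \<open>j\<close> possible. The \<open>j\<close> vertices
  still to be revealed are numbered from \<open>k\<close> on, so that the last one can be split
  off.\<close>

definition biclique :: "nat \<Rightarrow> nat \<Rightarrow> bit vec set \<Rightarrow> real" where
  "biclique k j B = avg (labels {..<k + j}) (\<lambda>x. of_bool (\<forall>i<k. x i \<in> B \<and>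
     (\<forall>l. k \<le> l \<and> l < k + j \<longrightarrow> f (x l) + f (x i) = f (x l + x i))))"

lemma density_nonneg: "0 \<le> density B"
  unfolding density_def by (rule avg_nonneg) simp

lemma density_V: "density V = 1"
  unfolding density_def by (subst avg_cong[where h = "\<lambda>_. 1"]) (auto simp: avg_const)

lemma density_nbhd_le: "density (nbhd B z) \<le> density B"
  unfolding density_def nbhd_def by (rule avg_mono) auto

lemma biclique_0: "biclique k 0 B = density B ^ k"
proof -
  have "avg (labels {..<k}) (\<lambda>x. of_bool (\<forall>i<k. x i \<in> B)) = density B ^ k"
  proof (induction k)
    case 0
    show ?case by (simp add: avg_const)
  next
    case (Suc k)
    have "avg (labels {..<Suc k}) (\<lambda>x. of_bool (\<forall>i<Suc k. x i \<in> B))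
        = avg V (\<lambda>z. avg (labels {..<k}) (\<lambda>x. of_bool (\<forall>i<Suc k. (x(k := z)) i \<in> B)))"
      unfolding lessThan_Suc by (rule avg_labels_insert) auto
    also have "\<dots> = avg V (\<lambda>z. avg (labels {..<k}) (\<lambda>x. of_bool (z \<in> B) * of_bool (\<forall>i<k. x i \<in> B)))"
      by (intro avg_cong) (auto simp: less_Suc_eq)
    also have "\<dots> = density B * density B ^ k"
      by (simp only: avg_cmult avg_multc Suc density_def)
    finally show ?case by simp
  qed
  moreover have "(\<lambda>x. of_bool (\<forall>i<k. x i \<in> B \<and> (\<forall>l. k \<le> l \<and> l < k \<longrightarrow> f (x l) + f (x i) = f (x l + x i))))
      = (\<lambda>x. of_bool (\<forall>i<k. x i \<in> B) :: real)"
    by (intro ext arg_cong[where f = of_bool]) auto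
  ultimately show ?thesis by (simp only: biclique_def add_0_right)
qed

text \<open>Once the label \<open>z\<close> of vertex \<open>k + j\<close> is known, its checks
  against the first \<open>k\<close> vertices say exactly that those lie in
  \<open>nbhd B z\<close>.\<close>

lemma biclique_Suc: "biclique k (Suc j) B = avg V (\<lambda>z. biclique k j (nbhd B z))"
proof -
  let ?P = "\<lambda>x j B. \<forall>i<k. x i \<in> B \<and>
     (\<forall>l. k \<le> l \<and> l < k + j \<longrightarrow> f (x l) + f (x i) = f (x l + x i))"
  have eq: "?P (x(k + j := z)) (Suc j) B \<longleftrightarrow> ?P x j (nbhd B z)" for x z
    by (auto simp: nbhd_def less_Suc_eq)
  have "biclique k (Suc j) B
      = avg V (\<lambda>z. avg (labels {..<k + j}) (\<lambda>x. of_bool (?P (x(k + j := z)) (Suc j) B)))"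
    unfolding biclique_def add_Suc_right lessThan_Suc by (rule avg_labels_insert) auto
  then show ?thesis by (simp only: eq biclique_def)
qed

text \<open>All remaining checks are dropped; this suffices once \<open>B\<close> is sparse.\<close>

lemma biclique_le_density: "biclique k j B \<le> density B ^ k"
proof (induction j arbitrary: B)
  case 0
  show ?case by (simp add: biclique_0)
next
  case (Suc j)
  have "biclique k j (nbhd B z) \<le> density B ^ k" for z
    using Suc[of "nbhd B z"] power_mono[OF density_nbhd_le density_nonneg] by (rule order_trans)
  then show ?case unfolding biclique_Suc by (intro avg_le_const) auto
qed

text \<open>Let \<open>X\<close> be the exceptional set, of density \<open>\<xi>\<close>, and let
  \<open>\<beta>\<close> be the density of \<open>B\<close>. Passing pairs between \<open>X\<close>
  and \<open>B\<close> have density at least \<open>3/4 * \<xi> * \<beta>\<close> by the choice of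
  \<open>X\<close>, but at most half of \<open>\<xi> * \<beta>\<close> plus an error of
  \<open>d / 2 * sqrt (\<xi> * \<beta>)\<close>. Hence \<open>\<xi> * \<beta>\<close> is at most
  \<open>4 * d * d\<close>, and \<open>d < \<beta>\<close> allows one factor to be
  cancelled.\<close>

lemma expander_mixing:
  assumes B: "d < density B"
  shows "density {z. 3 / 4 * density B < density (nbhd B z)} \<le> 4 * d"
proof -
  define X where "X = {z. 3 / 4 * density B < density (nbhd B z)}"
  define \<xi> where "\<xi> = density X"
  define \<beta> where "\<beta> = density B"
  let ?X = "\<lambda>z. of_bool (z \<in> X) :: real" and ?B = "\<lambda>y. of_bool (y \<in> B) :: real"
  have nn: "0 \<le> \<xi>" "0 \<le> \<beta>" by (simp_all add: \<xi>_def \<beta>_def density_nonneg)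
  have "3 / 4 * \<beta> * \<xi> = avg V (\<lambda>z. 3 / 4 * \<beta> * ?X z)"
    by (simp only: avg_cmult \<xi>_def density_def)
  also have "\<dots> \<le> avg V (\<lambda>z. ?X z * density (nbhd B z))"
    by (intro avg_mono) (auto simp: X_def \<beta>_def)
  also have "\<dots> = avg V (\<lambda>z. avg V (\<lambda>y. ?X z * of_bool (y \<in> nbhd B z)))"
    by (simp only: density_def avg_cmult)
  also have "\<dots> = avg V (\<lambda>z. avg V (\<lambda>y. 1 / 2 * (?X z * ?B y)
      + 1 / 2 * ((?X z * F z) * (?B y * F y) * F (z + y))))"
  proof (intro avg_cong)
    fix z y
    have "of_bool (y \<in> nbhd B z) = ?B y * edge z y"
      by (simp add: nbhd_def edge_def)
    then show "?X z * of_bool (y \<in> nbhd B z) = 1 / 2 * (?X z * ?B y)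
      + 1 / 2 * ((?X z * F z) * (?B y * F y) * F (z + y))"
      by (simp only: edge_eq) (simp add: field_simps)
  qed
  also have "\<dots> = 1 / 2 * (\<xi> * \<beta>)
      + 1 / 2 * avg V (\<lambda>z. avg V (\<lambda>y. (?X z * F z) * (?B y * F y) * F (z + y)))"
    by (simp only: avg_add avg_cmult avg_multc \<xi>_def \<beta>_def density_def)
  also have "avg V (\<lambda>z. avg V (\<lambda>y. (?X z * F z) * (?B y * F y) * F (z + y)))
      \<le> d * sqrt \<xi> * sqrt \<beta>"
  proof -
    \<comment> \<open>The signs square to 1, so the norms in the bilinear bound are square roots of
      densities.\<close>
    have sq: "(of_bool P * sign_bit a)\<^sup>2 = (of_bool P :: real)" for P a
      by (simp add: power2_eq_square)
    show ?thesis
      using bilinear_bound[of "\<lambda>z. ?X z * F z" "\<lambda>y. ?B y * F y"]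
      by (simp only: sq \<xi>_def \<beta>_def density_def)
  qed
  finally have "\<xi> * \<beta> \<le> 2 * (d * (sqrt \<xi> * sqrt \<beta>))"
    by (simp add: algebra_simps)
  then have le: "\<xi> * \<beta> \<le> 2 * d * sqrt (\<xi> * \<beta>)"
    by (simp add: real_sqrt_mult)
  have "sqrt (\<xi> * \<beta>) \<le> 2 * d"
  proof (cases "\<xi> * \<beta> = 0")
    case False
    then have pos: "0 < sqrt (\<xi> * \<beta>)" using nn by (simp add: less_le)
    have "sqrt (\<xi> * \<beta>) * sqrt (\<xi> * \<beta>) \<le> 2 * d * sqrt (\<xi> * \<beta>)" using le nn by simp
    then show ?thesis using pos by (rule mult_right_le_imp_le)
  qed (use max_corr_nonneg in auto)
  then have "\<xi> * \<beta> \<le> (2 * d)\<^sup>2"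
    using sqrt_le_D by blast
  also have "\<dots> = 4 * d * d" by (simp add: power2_eq_square)
  also have "\<dots> \<le> 4 * d * \<beta>"
    using B max_corr_nonneg by (intro mult_left_mono) (auto simp: \<beta>_def)
  finally have "\<xi> \<le> 4 * d"
    using B max_corr_nonneg by (simp add: \<beta>_def)
  then show ?thesis by (simp add: \<xi>_def X_def)
qed

text \<open>While the common neighbourhood \<open>B\<close> is denser than \<open>d\<close>, a further vertex shrinks its
  density by the factor \<open>3/4\<close>, except with probability \<open>4 d\<close>; once it is sparser, all \<open>k\<close>
  vertices hit it with probability at most \<open>d ^ k\<close>.\<close>

lemma biclique_le:
  "biclique k j B \<le> d ^ k + ((3 / 4) ^ k + 4 * d) ^ j * density B ^ k"
proof (induction j arbitrary: B)
  case 0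
  show ?case using max_corr_nonneg by (simp add: biclique_0)
next
  case (Suc j)
  define r where "r = (3 / 4) ^ k + 4 * d"
  define \<beta> where "\<beta> = density B"
  have r: "0 \<le> r" using max_corr_nonneg by (simp add: r_def)
  have \<beta>: "0 \<le> \<beta>" by (simp add: \<beta>_def density_nonneg)
  show ?case
  proof (cases "d < \<beta>")
    case False
    then have "\<beta> ^ k \<le> d ^ k" using \<beta> by (intro power_mono) auto
    moreover have "0 \<le> r ^ Suc j * \<beta> ^ k" using r \<beta> by simp
    ultimately show ?thesis
      using biclique_le_density[of k "Suc j" B] by (simp add: r_def \<beta>_def)
  next
    case True
    define X where "X = {z. 3 / 4 * \<beta> < density (nbhd B z)}"
    \<comment> \<open>The induction needs the \<open>k\<close>-th moment of the new density. Typical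
      \<open>z\<close> contribute the factor \<open>(3/4) ^ k\<close>; exceptional \<open>z\<close>
      gain nothing but have density at most \<open>4 * d\<close>.\<close>
    have "density (nbhd B z) ^ k \<le> (3 / 4) ^ k * \<beta> ^ k + \<beta> ^ k * of_bool (z \<in> X)" for z
    proof (cases "z \<in> X")
      case True
      have "density (nbhd B z) ^ k \<le> \<beta> ^ k"
        unfolding \<beta>_def by (rule power_mono[OF density_nbhd_le density_nonneg])
      then show ?thesis using True \<beta> by (simp add: add_increasing)
    next
      case False
      then have "density (nbhd B z) ^ k \<le> (3 / 4 * \<beta>) ^ k"
        by (intro power_mono density_nonneg) (simp add: X_def)
      then show ?thesis using False by (simp add: power_mult_distrib[symmetric])
    qed
    then have "avg V (\<lambda>z. density (nbhd B z) ^ k)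
        \<le> avg V (\<lambda>z. (3 / 4) ^ k * \<beta> ^ k + \<beta> ^ k * of_bool (z \<in> X))"
      by (rule avg_mono)
    also have "\<dots> = (3 / 4) ^ k * \<beta> ^ k + \<beta> ^ k * density X"
      by (simp only: avg_add avg_cmult avg_const[OF finite_V V_nonempty] density_def)
    also have "\<dots> \<le> (3 / 4) ^ k * \<beta> ^ k + \<beta> ^ k * (4 * d)"
      using expander_mixing[of B] True \<beta>
      by (intro add_left_mono mult_left_mono) (auto simp: X_def \<beta>_def)
    also have "\<dots> = r * \<beta> ^ k" by (simp add: r_def algebra_simps)
    finally have shrink: "avg V (\<lambda>z. density (nbhd B z) ^ k) \<le> r * \<beta> ^ k" .
    \<comment> \<open>The term \<open>d ^ k\<close> of the induction hypothesis does not depend on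
      \<open>z\<close>, so averaging leaves it unchanged instead of adding up over the
      rounds.\<close>
    have "biclique k (Suc j) B \<le> avg V (\<lambda>z. d ^ k + r ^ j * density (nbhd B z) ^ k)"
      unfolding biclique_Suc r_def by (rule avg_mono) (rule Suc)
    also have "\<dots> = d ^ k + r ^ j * avg V (\<lambda>z. density (nbhd B z) ^ k)"
      by (simp only: avg_add avg_cmult avg_const[OF finite_V V_nonempty])
    also have "\<dots> \<le> d ^ k + r ^ j * (r * \<beta> ^ k)"
      using shrink r by (intro add_left_mono mult_left_mono) auto
    finally show ?thesis by (simp add: r_def \<beta>_def mult_ac)
  qed
qed

text \<open>The first \<open>k\<close> vertices form one side and the last \<open>k\<close> the
  other; edges within a side are discarded. Initially the common neighbourhood is the whole space,
  of density 1.\<close>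

lemma accept_prob_le_biclique:
  "accept_prob (2 * k) m f \<le> d ^ k + ((3 / 4) ^ k + 4 * d) ^ k"
proof -
  have "accept_prob (2 * k) m f \<le> biclique k k V"
    unfolding accept_prob_eq biclique_def mult_2
  proof (rule avg_mono)
    fix x assume "x \<in> labels {..<k + k}"
    then show "of_bool (test_accepts (k + k) f x) \<le> (of_bool (\<forall>i<k. x i \<in> V \<and>
        (\<forall>l. k \<le> l \<and> l < k + k \<longrightarrow> f (x l) + f (x i) = f (x l + x i))) :: real)"
      by (auto simp: test_accepts_def intro: labels_in_V)
  qed
  also have "\<dots> \<le> d ^ k + ((3 / 4) ^ k + 4 * d) ^ k"
    using biclique_le[of k k V] by (simp add: density_V)
  finally show ?thesis .
qed

end

subsection \<open>The bounds in exponential form\<close>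

text \<open>The eighth power of \<open>3/4\<close> is below \<open>1/8\<close>, so
  \<open>3/4\<close> is at most \<open>2 powr (-3/8)\<close>. For \<open>k \<ge> 4\<close> the
  factor 2 costs at most \<open>k / 4\<close> in the exponent.\<close>

lemma two_times_three_quarters_power_le:
  assumes "k \<ge> 4"
  shows "2 * (3 / 4 :: real) ^ k \<le> 2 powr (- (real k / 8))"
proof -
  have "(2 powr (-3 / 8) :: real) ^ 8 = 2 powr (-3)"
    by (simp add: powr_power)
  also have "\<dots> = (1 / 8 :: real)"
    by (simp add: powr_minus_divide)
  finally have "(3 / 4 :: real) ^ 8 \<le> (2 powr (-3 / 8)) ^ 8"
    by (simp add: power_divide)
  then have "(3 / 4 :: real) \<le> 2 powr (-3 / 8)"
    by (simp add: power_mono_iff)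
  then have "(3 / 4 :: real) ^ k \<le> (2 powr (-3 / 8)) ^ k"
    by (intro power_mono) auto
  also have "\<dots> = 2 powr (-3 / 8 * real k)"
    by (simp add: powr_power mult.commute)
  finally have "2 * (3 / 4 :: real) ^ k \<le> 2 powr (1 + -3 / 8 * real k)"
    unfolding powr_add by simp
  also have "\<dots> \<le> 2 powr (- (real k / 8))"
    using assms by (intro powr_mono) auto
  finally show ?thesis .
qed

text \<open>A sum is at most twice its larger term. This separates the constant part from the part
  depending on \<open>d\<close> in the biclique bound.\<close>

lemma add_power_le:
  fixes a b :: real
  assumes "0 \<le> a" "0 \<le> b"
  shows "(a + b) ^ k \<le> (2 * a) ^ k + (2 * b) ^ k"
proof (cases "a \<le> b")
  case True
  then have "(a + b) ^ k \<le> (2 * b) ^ k" using assms by (intro power_mono) auto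
  then show ?thesis using assms by (simp add: add_increasing)
next
  case False
  then have "(a + b) ^ k \<le> (2 * a) ^ k" using assms by (intro power_mono) auto
  then show ?thesis using assms by (simp add: add_increasing2)
qed

text \<open>With \<open>s = t powr (1/16)\<close> it suffices that
  \<open>1 + s ^ 4 \<le> 2 * s\<close>, because \<open>s ^ 16 \<le> s ^ 4\<close>. The difference
  factors as \<open>(1 - s) * (s + s ^ 2 + s ^ 3 - 1)\<close>, and the lower bound on
  \<open>t\<close> forces \<open>s \<ge> 7/10\<close>, where the second factor is
  nonnegative.\<close>

lemma half_one_plus_le_powr:
  fixes t :: real
  assumes "1 / 256 \<le> t" "t \<le> 1"
  shows "(1 + t) / 2 \<le> t powr (1 / 16)"
proof -
  define s where "s = t powr (1 / 16)"
  have s16: "s ^ 16 = t" using assms by (simp add: s_def powr_power)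
  have s: "0 \<le> s" "s \<le> 1" using assms by (auto simp: s_def powr_le_one_le intro: powr_le1)
  have "7 / 10 \<le> s"
  proof (rule ccontr)
    assume "\<not> 7 / 10 \<le> s"
    then have "s ^ 16 \<le> (7 / 10) ^ 16" using s by (intro power_mono) auto
    also have "\<dots> < (1 / 256 :: real)" by (simp add: power_divide)
    finally show False using s16 assms by simp
  qed
  moreover from this have "(7 / 10) ^ 2 \<le> s ^ 2" by (intro power_mono) auto
  then have "49 / 100 \<le> s ^ 2" by (simp add: power2_eq_square)
  moreover have "0 \<le> s ^ 3" using s by simp
  ultimately have "0 \<le> s + s ^ 2 + s ^ 3 - 1" by linarith
  then have "0 \<le> (1 - s) * (s + s ^ 2 + s ^ 3 - 1)"
    using s by (intro mult_nonneg_nonneg) auto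
  also have "\<dots> = 2 * s - 1 - s ^ 4"
    by (simp add: algebra_simps power2_eq_square power3_eq_cube power4_eq_xxxx)
  finally have "1 + s ^ 4 \<le> 2 * s" by simp
  moreover have "s ^ 16 \<le> s ^ 4" using s by (intro power_decreasing) auto
  ultimately show ?thesis using s16 by (simp add: s_def)
qed

lemma accept_prob_even_le:
  assumes k: "k \<ge> 4"
  shows "accept_prob (2 * k) m f \<le> 2 powr (- (real k ^ 2 / 8)) + max_corr m f powr (real k / 16)"
proof -
  define d where "d = max_corr m f"
  have d: "0 \<le> d" "d \<le> 1" by (simp_all add: d_def max_corr_nonneg max_corr_le_1)
  show ?thesis
  proof (cases "1 / 256 \<le> d")
    case True
    have "accept_prob (2 * k) m f \<le> ((1 + d) / 2) ^ k"
      unfolding d_def by (rule accept_prob_le_matching)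
    also have "\<dots> \<le> (d powr (1 / 16)) ^ k"
      using True d by (intro power_mono half_one_plus_le_powr) auto
    also have "\<dots> = d powr (real k / 16)"
      using True by (subst powr_power) auto
    finally show ?thesis by (simp add: d_def add_increasing)
  next
    case False
    \<comment> \<open>Below the threshold \<open>1/256\<close>, \<open>s\<close> is at most
      \<open>1/16\<close>, so \<open>8 * d = 8 * s * s\<close> is at most \<open>s / 2\<close>. The
      spare factor \<open>1/2\<close> absorbs both \<open>d ^ k\<close> and
      \<open>(8 * d) ^ k\<close> into \<open>s ^ k\<close>.\<close>
    define s where "s = sqrt d"
    have s: "0 \<le> s" "s * s = d" using d by (simp_all add: s_def)
    have "s \<le> sqrt ((1 / 16)\<^sup>2)"
      unfolding s_def using False by (intro real_sqrt_le_mono) (simp add: power2_eq_square)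
    then have "s \<le> 1 / 16" by simp
    then have "8 * d \<le> s / 2"
      using s mult_right_mono[of s "1 / 16" s] by simp
    then have "(8 * d) ^ k \<le> (s / 2) ^ k" using d by (intro power_mono) auto
    moreover have "d ^ k \<le> (8 * d) ^ k" using d by (intro power_mono) auto
    moreover have "2 * (s / 2) ^ k \<le> s ^ k"
    proof -
      have "(2::real) ^ 1 \<le> 2 ^ k" using k by (intro power_increasing) auto
      from mult_left_mono[OF this, of "s ^ k"] show ?thesis
        using s by (simp add: power_divide field_simps)
    qed
    ultimately have d_part: "d ^ k + (8 * d) ^ k \<le> s ^ k" by linarith
    have "(2 * (3 / 4 :: real) ^ k) ^ k \<le> (2 powr (- (real k / 8))) ^ k"
      by (intro power_mono two_times_three_quarters_power_le k) auto
    also have "\<dots> = 2 powr (- (real k ^ 2 / 8))"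
      by (simp add: powr_power power2_eq_square)
    finally have const_part: "(2 * (3 / 4 :: real) ^ k) ^ k \<le> 2 powr (- (real k ^ 2 / 8))" .
    have "accept_prob (2 * k) m f \<le> d ^ k + ((3 / 4) ^ k + 4 * d) ^ k"
      unfolding d_def by (rule accept_prob_le_biclique)
    also have "\<dots> \<le> d ^ k + ((2 * (3 / 4) ^ k) ^ k + (2 * (4 * d)) ^ k)"
      using d by (intro add_left_mono add_power_le) auto
    also have "\<dots> \<le> 2 powr (- (real k ^ 2 / 8)) + s ^ k"
      using d_part const_part by simp
    also have "s ^ k = d powr (real k / 2)"
      using k d by (cases "d = 0") (simp_all add: s_def powr_half_sqrt[symmetric] powr_power)
    also have "\<dots> \<le> d powr (real k / 16)"
      using d by (intro powr_mono') auto
    finally show ?thesis by (simp add: d_def)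
  qed
qed

text \<open>For \<open>N \<ge> 8\<close>, \<open>k = N div 2\<close> is at least 4 and at least
  \<open>N / 4\<close>. The exponent of \<open>d\<close> could be \<open>N / 64\<close>; weakening
  it to \<open>N / 128\<close> gives both terms the same constant, so that one error function serves
  both.\<close>

lemma accept_prob_le:
  assumes "N \<ge> 8"
  shows "accept_prob N m f \<le> 2 powr (- (real N ^ 2 / 128)) + max_corr m f powr (real N / 128)"
proof -
  define k where "k = N div 2"
  have k: "k \<ge> 4" "2 * k \<le> N" "real N / 4 \<le> real k" using assms by (auto simp: k_def)
  have "accept_prob N m f \<le> accept_prob (2 * k) m f"
    using k by (intro accept_prob_antimono)
  also have "\<dots> \<le> 2 powr (- (real k ^ 2 / 8)) + max_corr m f powr (real k / 16)"
    using k by (intro accept_prob_even_le)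
  also have "\<dots> \<le> 2 powr (- (real N ^ 2 / 128)) + max_corr m f powr (real N / 128)"
  proof (intro add_mono[OF powr_mono powr_mono'] max_corr_nonneg max_corr_le_1)
    have "(real N / 4) ^ 2 \<le> real k ^ 2" using k by (intro power_mono) auto
    then show "- (real k ^ 2 / 8) \<le> - (real N ^ 2 / 128)" by (simp add: power_divide)
    show "real N / 128 \<le> real k / 16" using k by simp
  qed auto
  finally show ?thesis .
qed

theorem mainTheorem8:
  shows "\<exists>(\<epsilon> :: nat \<Rightarrow> real) (\<epsilon>' :: nat \<Rightarrow> real) (c :: real).
    \<epsilon> \<longlonglongrightarrow> 0 \<and> \<epsilon>' \<longlonglongrightarrow> 0 \<and> c > 0 \<and>
    (\<forall>\<^sub>F N in sequentially. \<forall>m\<ge>1. \<forall>f :: bit vec \<Rightarrow> bit.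
      accept_prob N m f \<le>
        min (2 powr (- real (N choose 2)) + max_corr m f)
          (min (2 powr (- (real N powr (2 - \<epsilon> N)))
                  + max_corr m f powr (real N powr (1 - \<epsilon> N)))
               (2 powr (- (c * real N ^ 2))
                  + max_corr m f powr (real N powr (1 - \<epsilon>' N)))))"
proof -
  \<comment> \<open>Chosen so that \<open>N powr \<epsilon> N = 128\<close>: subtracting
    \<open>\<epsilon> N\<close> from an exponent divides the power by 128.\<close>
  define \<epsilon> :: "nat \<Rightarrow> real" where "\<epsilon> N = ln 128 / ln (real N)" for N
  have lim: "\<epsilon> \<longlonglongrightarrow> 0"
    unfolding \<epsilon>_def by real_asymp
  have powr: "real N powr (a - \<epsilon> N) = real N powr a / 128" if "N \<ge> 8" for N a
  proof -
    have "real N powr \<epsilon> N = 128" using that by (simp add: \<epsilon>_def powr_def)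
    then show ?thesis by (simp add: powr_diff)
  qed
  have bound: "accept_prob N m f \<le>
        min (2 powr (- real (N choose 2)) + max_corr m f)
          (min (2 powr (- (real N powr (2 - \<epsilon> N)))
                  + max_corr m f powr (real N powr (1 - \<epsilon> N)))
               (2 powr (- (1 / 128 * real N ^ 2))
                  + max_corr m f powr (real N powr (1 - \<epsilon> N))))" if N: "N \<ge> 8" for N m f
  proof -
    have "accept_prob N m f \<le> 2 powr (- real (N choose 2)) + max_corr m f"
      using accept_prob_le_edges[of N m f] by (simp add: powr_minus powr_realpow power_one_over inverse_eq_divide)
    moreover have eq: "real N powr (2 - \<epsilon> N) = real N ^ 2 / 128" "real N powr (1 - \<epsilon> N) = real N / 128"
      using powr[OF N] N by (simp_all)
    ultimately show ?thesis
      unfolding eq using accept_prob_le[OF N, of m f] by simp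
  qed
  have "\<forall>\<^sub>F N in sequentially. \<forall>m\<ge>1. \<forall>f :: bit vec \<Rightarrow> bit.
      accept_prob N m f \<le>
        min (2 powr (- real (N choose 2)) + max_corr m f)
          (min (2 powr (- (real N powr (2 - \<epsilon> N)))
                  + max_corr m f powr (real N powr (1 - \<epsilon> N)))
               (2 powr (- (1 / 128 * real N ^ 2))
                  + max_corr m f powr (real N powr (1 - \<epsilon> N))))"
    using eventually_ge_at_top[of 8] by (rule eventually_mono) (use bound in blast)
  with lim show ?thesis
    \<comment> \<open>The same function is the witness for both error terms, so the second and third
      bounds coincide.\<close>
    by (intro exI[of _ \<epsilon>] exI[of _ "1 / 128 :: real"] conjI) auto
qed

end
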